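(* Let $K$ be $\mathbb{R}$ or $\mathbb{C}$, let $V$ be an $m$-dimensional vector space over $K$ equipped with a non-degenerate symmetric bilinear form $\langle\cdot,\cdot\rangle$, and let $V^n$ be equipped with a norm $\|\cdot\|$. Let $r=\min(n-1,m)$. Suppose that an $n$-point configuration $P_1,\ldots,P_n\in V$ is such that its distances $d_{\{i,j\}}=\langle P_i-P_j,P_i-P_j\rangle$ ($1\le i<j\le n$) are pairwise distinct and the matrix $$\left(d_{\{i,j\}}-d_{\{i,n\}}-d_{\{j,n\}}\right)_{i,j=1,\ldots,n-1}$$ (where $d_{\{i,i\}}:=0$) has rank $r$. Then there exists a neighborhood $N$ of $(P_1,\ldots,P_n)$ in $V^n$ such that any two $n$-point configurations in $N$ are in the same orbit under the action of $\mathrm{AO}(V)$ if and only if their distributions of distances are the same.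
   Context: $\mathrm{O}(V)$ is the orthogonal group of the form $\langle\cdot,\cdot\rangle$, and $\mathrm{AO}(V)$ is the group of maps $V\to V$ generated by $\mathrm{O}(V)$ and all translations; it acts diagonally on $V^n$ by $g\cdot(Q_1,\ldots,Q_n)=(g(Q_1),\ldots,g(Q_n))$. Two configurations $(Q_1,\ldots,Q_n)$ and $(R_1,\ldots,R_n)$ have the same distribution of distances if the multisets $\{\langle Q_i-Q_j,Q_i-Q_j\rangle : 1\le i<j\le n\}$ and $\{\langle R_i-R_j,R_i-R_j\rangle : 1\le i<j\le n\}$ coincide. Neighborhoods are with respect to the topology given by the norm. *)

theory Defs
  imports
    "HOL-Analysis.Abstract_Metric_Spaces"
    "HOL-Algebra.Bij"
    "HOL-Algebra.Generated_Groups"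
    "HOL-Library.Multiset"
    "Jordan_Normal_Form.DL_Rank"
begin

text \<open>
  The vector space \<open>V\<close> is the type \<open>'v\<close> together with an explicit scalar multiplication
  \<open>smul\<close>, so that the same definitions serve for real and for complex scalars and \<open>V\<close> may
  have any finite dimension, including \<open>0\<close>.
\<close>

definition has_dimension :: "('k::field \<Rightarrow> 'v::ab_group_add \<Rightarrow> 'v) \<Rightarrow> nat \<Rightarrow> bool"
  where "has_dimension smul m \<longleftrightarrow>
    (\<exists>Basis. finite_dimensional_vector_space smul Basis \<and> card Basis = m)"

locale nondegenerate_symmetric_form =
  fixes smul :: "'k::field \<Rightarrow> 'v::ab_group_add \<Rightarrow> 'v" and form :: "'v \<Rightarrow> 'v \<Rightarrow> 'k"
  assumes linear_left: "Vector_Spaces.linear smul (*) (\<lambda>x. form x y)"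
    and linear_right: "Vector_Spaces.linear smul (*) (\<lambda>y. form x y)"
    and symmetric: "form x y = form y x"
    and nondegenerate: "(\<And>y. form x y = 0) \<Longrightarrow> x = 0"

definition dist_form :: "('v::ab_group_add \<Rightarrow> 'v \<Rightarrow> 'k) \<Rightarrow> 'v \<Rightarrow> 'v \<Rightarrow> 'k"
  where "dist_form form x y = form (x - y) (x - y)"

definition orthogonal_group ::
  "('k::field \<Rightarrow> 'v::ab_group_add \<Rightarrow> 'v) \<Rightarrow> ('v \<Rightarrow> 'v \<Rightarrow> 'k) \<Rightarrow> ('v \<Rightarrow> 'v) set"
  where "orthogonal_group smul form =
    {f. Vector_Spaces.linear smul smul f \<and> bij f \<and> (\<forall>x y. form (f x) (f y) = form x y)}"

definition translation_maps :: "('v::ab_group_add \<Rightarrow> 'v) set"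
  where "translation_maps = range (\<lambda>v x. x + v)"

text \<open>The group generated is taken inside the group of all permutations of \<open>V\<close>.\<close>

definition affine_orthogonal_group ::
  "('k::field \<Rightarrow> 'v::ab_group_add \<Rightarrow> 'v) \<Rightarrow> ('v \<Rightarrow> 'v \<Rightarrow> 'k) \<Rightarrow> ('v \<Rightarrow> 'v) set"
  where "affine_orthogonal_group smul form =
    generate (BijGroup UNIV) (orthogonal_group smul form \<union> translation_maps)"

text \<open>
  Elements of \<open>V\<^sup>n\<close> are functions that are \<open>undefined\<close> outside \<open>{1..n}\<close>; hence the
  operations on \<open>V\<^sup>n\<close> are restricted to \<open>{1..n}\<close>.
\<close>

definition configs :: "nat \<Rightarrow> (nat \<Rightarrow> 'v) set"
  where "configs n = {1..n} \<rightarrow>\<^sub>E UNIV"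

locale norm_on_configs =
  fixes smul :: "'k::real_normed_field \<Rightarrow> 'v::ab_group_add \<Rightarrow> 'v"
    and n :: nat and nrm :: "(nat \<Rightarrow> 'v) \<Rightarrow> real"
  assumes nonneg: "P \<in> configs n \<Longrightarrow> nrm P \<ge> 0"
    and eq_zero_iff: "P \<in> configs n \<Longrightarrow> nrm P = 0 \<longleftrightarrow> (\<forall>i\<in>{1..n}. P i = 0)"
    and homogeneous: "P \<in> configs n \<Longrightarrow> nrm (\<lambda>i\<in>{1..n}. smul c (P i)) = norm c * nrm P"
    and triangle: "P \<in> configs n \<Longrightarrow> Q \<in> configs n \<Longrightarrow>
      nrm (\<lambda>i\<in>{1..n}. P i + Q i) \<le> nrm P + nrm Q"

definition config_topology ::
  "nat \<Rightarrow> ((nat \<Rightarrow> 'v::ab_group_add) \<Rightarrow> real) \<Rightarrow> (nat \<Rightarrow> 'v) topology"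
  where "config_topology n nrm =
    Metric_space.mtopology (configs n) (\<lambda>P Q. nrm (\<lambda>i\<in>{1..n}. P i - Q i))"

definition neighborhood ::
  "nat \<Rightarrow> ((nat \<Rightarrow> 'v::ab_group_add) \<Rightarrow> real) \<Rightarrow> (nat \<Rightarrow> 'v) \<Rightarrow> (nat \<Rightarrow> 'v) set \<Rightarrow> bool"
  where "neighborhood n nrm P N \<longleftrightarrow>
    N \<subseteq> configs n \<and> (\<exists>U. openin (config_topology n nrm) U \<and> P \<in> U \<and> U \<subseteq> N)"

definition same_orbit ::
  "('k::field \<Rightarrow> 'v::ab_group_add \<Rightarrow> 'v) \<Rightarrow> ('v \<Rightarrow> 'v \<Rightarrow> 'k) \<Rightarrow> nat \<Rightarrow>
    (nat \<Rightarrow> 'v) \<Rightarrow> (nat \<Rightarrow> 'v) \<Rightarrow> bool"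
  where "same_orbit smul form n Q R \<longleftrightarrow>
    (\<exists>g\<in>affine_orthogonal_group smul form. R = (\<lambda>i\<in>{1..n}. g (Q i)))"

definition index_pairs :: "nat \<Rightarrow> (nat \<times> nat) set"
  where "index_pairs n = {(i, j). 1 \<le> i \<and> i < j \<and> j \<le> n}"

definition distance_distribution ::
  "('v::ab_group_add \<Rightarrow> 'v \<Rightarrow> 'k) \<Rightarrow> nat \<Rightarrow> (nat \<Rightarrow> 'v) \<Rightarrow> 'k multiset"
  where "distance_distribution form n Q =
    image_mset (\<lambda>(i, j). dist_form form (Q i) (Q j)) (mset_set (index_pairs n))"

definition distinct_distances ::
  "('v::ab_group_add \<Rightarrow> 'v \<Rightarrow> 'k) \<Rightarrow> nat \<Rightarrow> (nat \<Rightarrow> 'v) \<Rightarrow> bool"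
  where "distinct_distances form n P \<longleftrightarrow>
    inj_on (\<lambda>(i, j). dist_form form (P i) (P j)) (index_pairs n)"

text \<open>Matrices are indexed from \<open>0\<close>, hence the shift of the indices \<open>1, \<dots>, n - 1\<close>.\<close>

definition distance_matrix ::
  "('v::ab_group_add \<Rightarrow> 'v \<Rightarrow> 'k::field) \<Rightarrow> nat \<Rightarrow> (nat \<Rightarrow> 'v) \<Rightarrow> 'k mat"
  where "distance_matrix form n P =
    mat (n - 1) (n - 1) (\<lambda>(i, j).
      dist_form form (P (i + 1)) (P (j + 1))
      - dist_form form (P (i + 1)) (P n) - dist_form form (P (j + 1)) (P n))"

end

theory Submission
  imports Defs
begin

text \<open>
Write \<open>v\<^sub>j = Q\<^sub>j - Q\<^sub>n\<close> for the edges of a configuration \<open>Q\<close>. By polarization the distances of \<open>Q\<close>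
determine the Gram matrix of the edges, and the matrix in the rank hypothesis is \<open>- 2\<close> times it.

Elements of \<open>AO(V)\<close> preserve all distances, so only one direction needs an argument. It splits
into a combinatorial and a geometric part. Since the distances of \<open>P\<close> are pairwise distinct, any
two configurations close to \<open>P\<close> with the same multiset of distances have the same labelled
distances: a distance can only be matched with one close to the same distance of \<open>P\<close>
(\<open>equal_multisets_near_injective_family\<close>). It remains to see that configurations near \<open>P\<close> with
the same labelled distances, hence with the same Gram matrix of edges, lie in one orbit.

This is Witt's extension theorem, and it needs the span of the edges to be a non-degenerate
subspace (\<open>isometry_of_equal_gram\<close>): in general equal Gram matrices do not suffice, as a nonzero
isotropic vector and the zero vector show. The rank hypothesis excludes this. It yields \<open>r\<close>
independent columns of the Gram matrix (\<open>rank_attained_by_independent_columns\<close>), so the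
corresponding edges are independent. Either \<open>r = m\<close>, and the edges span \<open>V\<close>, or \<open>r = n - 1\<close>, and
the whole Gram matrix is invertible; in both cases the span is non-degenerate
(\<open>nondegenerate_on_span_if_independent_gram_columns\<close>).

Independence of chosen columns persists under small perturbations of the matrix
(\<open>eventually_independent_columns\<close>), and the entries of the Gram matrix depend continuously on the
configuration (\<open>tendsto_form_of_differences\<close>). Both facts rest on one compactness argument: on a
finite-dimensional space every norm bounds the coordinates (\<open>coordinates_bounded_by_norm\<close>). It is
applied once to the given norm on configurations, and once to the norm \<open>c \<mapsto> \<Sum>\<^sub>i \<bar>\<Sum>\<^sub>j c\<^sub>j a\<^sub>i\<^sub>j\<bar>\<close>
attached to a matrix \<open>a\<close> with independent columns.
\<close>

section \<open>Coordinates are bounded by every norm\<close>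

text \<open>
If no constant works, there are vectors whose coordinates have absolute sum \<open>1\<close> but whose norms
tend to \<open>0\<close>. By compactness a subsequence converges coordinatewise. The norm is dominated by the
coordinates, so the limit has norm \<open>0\<close>, although its coordinates still have absolute sum \<open>1\<close>.

Vectors are functions on an arbitrary type of which only the values on \<open>I\<close> matter; this makes the
lemma applicable to tuples of vectors, indexed by pairs.
\<close>

lemma coordinates_bounded_by_norm:
  fixes p :: "('i \<Rightarrow> 'k::{real_normed_field, heine_borel}) \<Rightarrow> real"
  assumes I: "finite I"
    and triangle: "\<And>x y. p (\<lambda>i. x i + y i) \<le> p x + p y"
    and homogeneous: "\<And>c x. p (\<lambda>i. c * x i) = norm c * p x"
    and definite: "\<And>x i. p x = 0 \<Longrightarrow> i \<in> I \<Longrightarrow> x i = 0"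
    and local: "\<And>x y. (\<And>i. i \<in> I \<Longrightarrow> x i = y i) \<Longrightarrow> p x = p y"
  shows "\<exists>C>0. \<forall>x. \<forall>i\<in>I. norm (x i) \<le> C * p x"
proof (rule ccontr)
  assume contr: "\<not> ?thesis"
  \<comment> \<open>The standard unit vectors, which show that \<open>p\<close> is dominated by the coordinates.\<close>
  define u where "u i = (\<lambda>j. if j = i then 1 else 0 :: 'k)" for i :: 'i
  have p_zero: "p (\<lambda>_. 0) = 0"
    using homogeneous[of 0 "\<lambda>_. 0"] by simp
  have nonneg: "p x \<ge> 0" for x
    using triangle[of x "\<lambda>i. -1 * x i"] homogeneous[of "-1" x] p_zero by simp
  have p_sum: "p (\<lambda>j. \<Sum>i\<in>F. z i * u i j) \<le> (\<Sum>i\<in>F. norm (z i) * p (u i))" if "finite F" for F z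
    using that
  proof (induction F)
    case (insert i F)
    have "p (\<lambda>j. z i * u i j + (\<Sum>i\<in>F. z i * u i j)) \<le>
        norm (z i) * p (u i) + p (\<lambda>j. \<Sum>i\<in>F. z i * u i j)"
      using triangle[of "\<lambda>j. z i * u i j" "\<lambda>j. \<Sum>i\<in>F. z i * u i j"] homogeneous[of "z i" "u i"]
      by simp
    then show ?case using insert by simp
  qed (simp add: p_zero)
  have p_upper: "p z \<le> (\<Sum>i\<in>I. norm (z i) * p (u i))" for z
  proof -
    have "p z = p (\<lambda>j. \<Sum>i\<in>I. z i * u i j)"
      using I by (intro local) (simp add: u_def if_distrib[of "(*) _"] sum.delta cong: if_cong)
    then show ?thesis using p_sum[OF I, of z] by simp
  qed
  have "\<exists>y. (\<Sum>i\<in>I. norm (y i)) = 1 \<and> p y \<le> inverse (Suc k)" for k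
  proof -
    have "\<not> (\<forall>x. \<forall>i\<in>I. norm (x i) \<le> real (Suc k) * p x)"
      using contr of_nat_0_less_iff[of "Suc k"] by blast
    then obtain x i where x: "i \<in> I" "real (Suc k) * p x < norm (x i)"
      by (auto simp: not_le)
    define s where "s = (\<Sum>i\<in>I. norm (x i))"
    have s: "norm (x i) \<le> s"
      unfolding s_def using I x(1) by (intro member_le_sum) auto
    have s_pos: "s > 0"
      using x(2) s nonneg[of x] by (smt (verit) mult_nonneg_nonneg of_nat_0_le_iff)
    \<comment> \<open>Rescaling a vector that violates the bound \<open>k + 1\<close>.\<close>
    define y where "y = (\<lambda>i. of_real (inverse s) * x i)"
    have "(\<Sum>i\<in>I. norm (y i)) = inverse s * s"
      unfolding y_def s_def[symmetric] norm_mult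
      using s_pos by (simp add: s_def flip: sum_distrib_left of_real_inverse)
    moreover have "p y = inverse s * p x"
      unfolding y_def homogeneous norm_of_real using s_pos by simp
    moreover have "inverse s * p x \<le> inverse (Suc k)"
      using x(2) s s_pos by (simp add: field_simps)
    ultimately show ?thesis using s_pos by (intro exI[of _ y]) auto
  qed
  then obtain y where y: "\<And>k. (\<Sum>i\<in>I. norm (y k i)) = 1" "\<And>k. p (y k) \<le> inverse (Suc k)"
    by metis
  have "norm (y k i) \<le> 1" if "i \<in> I" for k i
    using member_le_sum[of i I "\<lambda>i. norm (y k i)"] I that y(1)[of k] by simp
  then have bounded_y: "bounded ((\<lambda>x. x i) ` range y)" if "i \<in> I" for i
    using that by (auto simp: bounded_iff)
  obtain l r where r: "strict_mono (r :: nat \<Rightarrow> nat)"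
    and l: "\<And>e. e > 0 \<Longrightarrow> \<forall>\<^sub>F n in sequentially. \<forall>i\<in>I. dist (y (r n) i) (l i) < e"
    using compact_lemma_general[of I "\<lambda>x. x" y "\<lambda>x. x"] I bounded_y by blast
  have lim: "(\<lambda>n. y (r n) i) \<longlonglongrightarrow> l i" if "i \<in> I" for i
  proof (rule tendstoI)
    fix e :: real assume "e > 0"
    from l[OF this] show "\<forall>\<^sub>F n in sequentially. dist (y (r n) i) (l i) < e"
      by eventually_elim (use that in auto)
  qed
  have "(\<lambda>n. \<Sum>i\<in>I. norm (y (r n) i)) \<longlonglongrightarrow> (\<Sum>i\<in>I. norm (l i))"
    using lim by (intro tendsto_intros)
  then have l_norm: "(\<Sum>i\<in>I. norm (l i)) = 1"
    unfolding y(1) by (simp add: LIMSEQ_const_iff)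
  have "p l \<le> inverse (Suc n) + (\<Sum>i\<in>I. norm (l i - y (r n) i) * p (u i))" for n
  proof -
    have "p l \<le> p (y (r n)) + p (\<lambda>i. l i - y (r n) i)"
      using triangle[of "y (r n)" "\<lambda>i. l i - y (r n) i"] by simp
    also have "p (y (r n)) \<le> inverse (Suc n)"
      using y(2)[of "r n"] seq_suble[OF r, of n] inverse_of_nat_le[of "Suc n" "Suc (r n)", where ?'a = real]
      by (simp add: inverse_eq_divide)
    finally show ?thesis using p_upper[of "\<lambda>i. l i - y (r n) i"] by simp
  qed
  moreover have "(\<lambda>n. inverse (real (Suc n)) + (\<Sum>i\<in>I. norm (l i - y (r n) i) * p (u i)))
      \<longlonglongrightarrow> 0 + (\<Sum>i\<in>I. norm (l i - l i) * p (u i))"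
    using lim by (intro tendsto_intros LIMSEQ_inverse_real_of_nat)
  ultimately have "p l \<le> 0"
    by (intro LIMSEQ_le_const[of _ 0]) auto
  then have "p l = 0"
    using nonneg[of l] by simp
  then have "(\<Sum>i\<in>I. norm (l i)) = 0"
    using definite by simp
  then show False
    using l_norm by simp
qed


section \<open>Linear independence of the columns of a matrix\<close>

text \<open>
Stated for a function of two indices rather than for a matrix, so that rows and columns can be
restricted to subsets without renumbering.
\<close>

definition independent_columns :: "'i set \<Rightarrow> 'j set \<Rightarrow> ('i \<Rightarrow> 'j \<Rightarrow> 'k::field) \<Rightarrow> bool"
  where "independent_columns I J a \<longleftrightarrow>
    (\<forall>c. (\<forall>i\<in>I. (\<Sum>j\<in>J. c j * a i j) = 0) \<longrightarrow> (\<forall>j\<in>J. c j = 0))"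

text \<open>
Independence of the columns means that \<open>c \<mapsto> \<Sum>\<^sub>i \<bar>\<Sum>\<^sub>j c\<^sub>j a\<^sub>i\<^sub>j\<bar>\<close> is a norm, so some multiple
\<open>C\<close> of it bounds every \<open>\<bar>c\<^sub>j\<bar>\<close>. If \<open>c\<close> is a relation between the columns of a nearby matrix \<open>b\<close>, then
its norm is at most \<open>C \<cdot> \<Sum>\<^sub>i\<^sub>j \<bar>a\<^sub>i\<^sub>j - b\<^sub>i\<^sub>j\<bar>\<close> times itself, and this factor is below \<open>1\<close>. The argument
works for rectangular matrices, where a determinant would require a choice of minor.
\<close>

lemma eventually_independent_columns:
  fixes a :: "'i \<Rightarrow> 'j \<Rightarrow> 'k::{real_normed_field, heine_borel}"
  assumes fin: "finite I" "finite J"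
    and indep: "independent_columns I J a"
    and lim: "\<And>i j. i \<in> I \<Longrightarrow> j \<in> J \<Longrightarrow> ((\<lambda>x. b x i j) \<longlongrightarrow> a i j) F"
  shows "\<forall>\<^sub>F x in F. independent_columns I J (b x)"
proof -
  define p where "p c = (\<Sum>i\<in>I. norm (\<Sum>j\<in>J. c j * a i j))" for c
  have "\<exists>C>0. \<forall>c. \<forall>j\<in>J. norm (c j) \<le> C * p c"
  proof (rule coordinates_bounded_by_norm[OF fin(2)])
    show "p (\<lambda>j. x j + y j) \<le> p x + p y" for x y
      unfolding p_def sum.distrib[symmetric] distrib_right
      by (intro sum_mono) (simp add: sum.distrib norm_triangle_ineq)
    show "p (\<lambda>j. c * x j) = norm c * p x" for c x
      unfolding p_def by (simp add: mult.assoc norm_mult flip: sum_distrib_left)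
    show "x j = 0" if "p x = 0" "j \<in> J" for x j
    proof -
      have "\<forall>i\<in>I. (\<Sum>j\<in>J. x j * a i j) = 0"
        using that(1) fin(1) by (simp add: p_def sum_nonneg_eq_0_iff)
      then show ?thesis
        using indep that(2) unfolding independent_columns_def by blast
    qed
    show "p x = p y" if "\<And>j. j \<in> J \<Longrightarrow> x j = y j" for x y
      using that unfolding p_def by simp
  qed
  then obtain C where C: "C > 0" "\<And>c j. j \<in> J \<Longrightarrow> norm (c j) \<le> C * p c" by blast
  have "((\<lambda>x. C * (\<Sum>i\<in>I. \<Sum>j\<in>J. norm (a i j - b x i j))) \<longlongrightarrow>
      C * (\<Sum>i\<in>I. \<Sum>j\<in>J. norm (a i j - a i j))) F"
    using lim by (intro tendsto_intros)
  then have "\<forall>\<^sub>F x in F. C * (\<Sum>i\<in>I. \<Sum>j\<in>J. norm (a i j - b x i j)) < 1"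
    by (rule order_tendstoD) simp
  then show ?thesis
  proof eventually_elim
    case (elim x)
    define \<delta> where "\<delta> = (\<Sum>i\<in>I. \<Sum>j\<in>J. norm (a i j - b x i j))"
    show ?case
      unfolding independent_columns_def
    proof (intro allI impI)
      fix c assume c: "\<forall>i\<in>I. (\<Sum>j\<in>J. c j * b x i j) = 0"
      have "p c = (\<Sum>i\<in>I. norm (\<Sum>j\<in>J. c j * (a i j - b x i j)))"
        unfolding p_def using c by (intro sum.cong) (simp_all add: right_diff_distrib sum_subtractf)
      also have "\<dots> \<le> (\<Sum>i\<in>I. \<Sum>j\<in>J. norm (c j * (a i j - b x i j)))"
        by (intro sum_mono norm_sum)
      also have "\<dots> \<le> (\<Sum>i\<in>I. \<Sum>j\<in>J. (C * p c) * norm (a i j - b x i j))"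
        unfolding norm_mult by (intro sum_mono mult_right_mono C) auto
      also have "\<dots> = (C * \<delta>) * p c"
        unfolding \<delta>_def by (simp add: sum_distrib_left mult_ac)
      finally have "(1 - C * \<delta>) * p c \<le> 0"
        by (simp add: algebra_simps)
      then have "p c \<le> 0"
        using elim unfolding \<delta>_def by (simp add: mult_le_0_iff)
      then have "C * p c \<le> 0"
        using C(1) by (simp add: mult_nonneg_nonpos)
      then show "\<forall>j\<in>J. c j = 0"
        using C(2)[of _ c] by (meson norm_le_zero_iff order_trans)
    qed
  qed
qed

text \<open>
The rank is the size of a maximal independent set of column vectors. Choosing an index for each of
these vectors turns the set of vectors into a set of indices.
\<close>

lemma rank_attained_by_independent_columns:
  fixes A :: "'k::field mat"
  assumes A: "A \<in> carrier_mat nr nc"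
  shows "\<exists>J\<subseteq>{..<nc}. card J = vec_space.rank nr A \<and>
    independent_columns {..<nr} J (\<lambda>i j. A $$ (i, j))"
proof -
  interpret vec_space "TYPE('k)" nr .
  obtain S where S: "maximal S (\<lambda>T. T \<subseteq> set (cols A) \<and> lin_indpt T)"
    using maximal_exists_superset[of "set (cols A)" "\<lambda>T. T \<subseteq> set (cols A) \<and> lin_indpt T" "{}"]
    by (auto simp: lin_dep_def)
  have rank: "rank A = card S"
    using A S by (rule rank_card_indpt)
  have S_cols: "S \<subseteq> set (cols A)" and indep: "lin_indpt S"
    using S by (auto simp: maximal_def)
  have "\<forall>s\<in>S. \<exists>j<nc. col A j = s"
    using S_cols A by (fastforce simp: cols_def)
  then obtain g where g: "\<And>s. s \<in> S \<Longrightarrow> g s < nc \<and> col A (g s) = s"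
    by metis
  have inj: "inj_on g S"
    using g by (metis inj_onI)
  have S_carrier: "S \<subseteq> carrier_vec nr"
    using S_cols A by (auto simp: cols_def)
  have finS: "finite S"
    using S_cols finite_subset by blast
  have "independent_columns {..<nr} (g ` S) (\<lambda>i j. A $$ (i, j))"
    unfolding independent_columns_def
  proof (intro allI impI)
    fix c assume c: "\<forall>i\<in>{..<nr}. (\<Sum>j\<in>g ` S. c j * A $$ (i, j)) = 0"
    have "lincomb (c \<circ> g) S = 0\<^sub>v nr"
    proof (rule eq_vecI)
      fix i assume i: "i < dim_vec (0\<^sub>v nr :: 'k vec)"
      have "lincomb (c \<circ> g) S $ i = (\<Sum>s\<in>S. c (g s) * s $ i)"
        using i S_carrier by (simp add: lincomb_index)
      also have "\<dots> = (\<Sum>s\<in>S. c (g s) * A $$ (i, g s))"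
        using i A g by (intro sum.cong) (auto, metis carrier_matD index_col)
      also have "\<dots> = 0"
        using c i by (simp add: sum.reindex[OF inj])
      finally show "lincomb (c \<circ> g) S $ i = 0\<^sub>v nr $ i"
        using i by simp
    qed (use S_carrier finS in \<open>simp add: lincomb_dim\<close>)
    then have "(c \<circ> g) \<in> S \<rightarrow> {\<zero>\<^bsub>class_ring\<^esub>}"
      using not_lindepD[OF indep finS subset_refl, of "c \<circ> g"] by (simp add: module_vec_simps)
    then show "\<forall>j\<in>g ` S. c j = 0"
      by (auto simp: class_field_def class_ring_simps)
  qed
  then show ?thesis
    using rank card_image[OF inj] g by (intro exI[of _ "g ` S"]) auto
qed

section \<open>Extending isometries in a quadratic space\<close>

locale quadratic_space =
  finite_dimensional_vector_space smul B + nondegenerate_symmetric_form smul form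
  for smul :: "'k::field_char_0 \<Rightarrow> 'v::ab_group_add \<Rightarrow> 'v" (infixr \<open>\<odot>\<close> 75)
    and B :: "'v set" and form :: "'v \<Rightarrow> 'v \<Rightarrow> 'k"
begin

interpretation form_left: Vector_Spaces.linear smul "(*)" "\<lambda>x. form x y" for y
  by (rule linear_left)

interpretation form_right: Vector_Spaces.linear smul "(*)" "\<lambda>y. form x y" for x
  by (rule linear_right)

interpretation endo: vector_space_pair smul smul
  by unfold_locales

lemmas form_simps =
  form_left.add form_left.scale form_left.diff form_left.neg form_left.zero
  form_right.add form_right.scale form_right.diff form_right.neg form_right.zero

lemma orthogonal_group_comp:
  assumes "f \<in> orthogonal_group smul form" "g \<in> orthogonal_group smul form"
  shows "g \<circ> f \<in> orthogonal_group smul form"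
  using assms unfolding orthogonal_group_def
  by (auto intro: Vector_Spaces.linear_compose bij_comp)

lemma id_in_orthogonal_group: "id \<in> orthogonal_group smul form"
  unfolding orthogonal_group_def by (auto simp: linear_id)

text \<open>
The orthogonal reflection in the hyperplane \<open>u\<^sup>\<bottom>\<close>, meaningful when \<open>u\<close> is anisotropic.
\<close>

definition reflection :: "'v \<Rightarrow> 'v \<Rightarrow> 'v"
  where "reflection u x = x - (2 * form x u / form u u) \<odot> u"

lemma reflection_in_orthogonal_group:
  assumes "form u u \<noteq> 0"
  shows "reflection u \<in> orthogonal_group smul form"
proof -
  have involution: "reflection u (reflection u x) = x" for x
    using assms by (simp add: reflection_def form_simps algebra_simps)
  then have "bij (reflection u)"
    by (intro o_bij[of "reflection u"]) auto
  moreover have "Vector_Spaces.linear smul smul (reflection u)"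
    unfolding Vector_Spaces.linear_iff
    by (simp add: vector_space_axioms reflection_def form_simps algebra_simps add_divide_distrib)
  moreover have "form (reflection u x) (reflection u y) = form x y" for x y
    using assms symmetric[of u y] by (simp add: reflection_def form_simps field_simps)
  ultimately show ?thesis by (simp add: orthogonal_group_def)
qed

lemma reflection_fixes_orthogonal: "form z u = 0 \<Longrightarrow> reflection u z = z"
  by (simp add: reflection_def)

lemma reflection_swaps:
  assumes "form a a = form b b" "form (a - b) (a - b) \<noteq> 0"
  shows "reflection (a - b) a = b"
proof -
  have "form (a - b) (a - b) = 2 * form a (a - b)"
    using assms(1) symmetric[of b a] by (simp add: form_simps)
  then show ?thesis
    using assms(2) by (simp add: reflection_def)
qed

text \<open>
The reflection along \<open>a - b\<close> does this if \<open>a - b\<close> is anisotropic. Otherwise, as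
\<open>\<langle>a - b, a - b\<rangle> + \<langle>a + b, a + b\<rangle> = 4 \<langle>a, a\<rangle> \<noteq> 0\<close>, the vector \<open>a + b\<close> is anisotropic; the reflection
along it sends \<open>a\<close> to \<open>- b\<close>, and the one along \<open>b\<close> then corrects the sign. All these reflections
fix the vectors orthogonal to both \<open>a\<close> and \<open>b\<close>, which lets partial isometries be extended one
vector at a time.
\<close>

lemma exists_isometry_moving_vector:
  assumes norm_eq: "form a a = form b b" and aniso: "form a a \<noteq> 0"
  shows "\<exists>g\<in>orthogonal_group smul form.
    g a = b \<and> (\<forall>z. form z a = 0 \<longrightarrow> form z b = 0 \<longrightarrow> g z = z)"
proof (cases "form (a - b) (a - b) = 0")
  case False
  then show ?thesis
    by (intro bexI[of _ "reflection (a - b)"])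
      (auto simp: reflection_swaps norm_eq form_simps
        intro!: reflection_fixes_orthogonal reflection_in_orthogonal_group)
next
  case True
  have "form (a + b) (a + b) + form (a - b) (a - b) = 4 * form a a"
    using norm_eq by (simp add: form_simps)
  then have sum_aniso: "form (a + b) (a + b) \<noteq> 0"
    using True aniso by auto
  have b_aniso: "form b b \<noteq> 0"
    using assms by simp
  have "reflection (a + b) a = - b"
    using reflection_swaps[of a "- b"] norm_eq sum_aniso by (simp add: form_simps)
  moreover have "reflection b (- b) = b"
    using b_aniso by (simp add: reflection_def form_simps scale_left_distrib[of 1 1, simplified])
  ultimately have "(reflection b \<circ> reflection (a + b)) a = b"
    by simp
  moreover have "reflection b \<circ> reflection (a + b) \<in> orthogonal_group smul form"
    by (intro orthogonal_group_comp reflection_in_orthogonal_group sum_aniso b_aniso)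
  moreover have "(reflection b \<circ> reflection (a + b)) z = z" if "form z a = 0" "form z b = 0" for z
    using that by (simp add: reflection_fixes_orthogonal form_simps)
  ultimately show ?thesis by blast
qed

definition orthogonal_family :: "'v set \<Rightarrow> bool"
  where "orthogonal_family E \<longleftrightarrow>
    (\<forall>e\<in>E. form e e \<noteq> 0) \<and> (\<forall>e\<in>E. \<forall>e'\<in>E. e \<noteq> e' \<longrightarrow> form e e' = 0)"

text \<open>
By induction: when \<open>f\<close> already has the right values on \<open>E\<close> and \<open>e\<close> is a new vector, both \<open>f e\<close> and
\<open>h e\<close> are orthogonal to \<open>h ` E\<close>, so moving \<open>f e\<close> to \<open>h e\<close> as above leaves \<open>h ` E\<close> alone.
\<close>

lemma extend_isometry_of_orthogonal_family:
  assumes "finite E" "orthogonal_family E"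
    and "\<And>e e'. e \<in> E \<Longrightarrow> e' \<in> E \<Longrightarrow> form (h e) (h e') = form e e'"
  shows "\<exists>f\<in>orthogonal_group smul form. \<forall>e\<in>E. f e = h e"
  using assms
proof (induction E rule: finite_induct)
  case empty
  then show ?case using id_in_orthogonal_group by blast
next
  case (insert e E)
  have "orthogonal_family E"
    using insert.prems(1) by (auto simp: orthogonal_family_def)
  then obtain f where f: "f \<in> orthogonal_group smul form" "\<forall>e\<in>E. f e = h e"
    using insert by auto
  have f_isom: "form (f x) (f y) = form x y" for x y
    using f(1) by (auto simp: orthogonal_group_def)
  have "form (f e) (f e) = form (h e) (h e)" "form (f e) (f e) \<noteq> 0"
    using insert.prems by (auto simp: f_isom orthogonal_family_def)
  then obtain g where g: "g \<in> orthogonal_group smul form" "g (f e) = h e"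
    "\<And>z. form z (f e) = 0 \<Longrightarrow> form z (h e) = 0 \<Longrightarrow> g z = z"
    using exists_isometry_moving_vector[of "f e" "h e"] by blast
  have "g (h e') = h e'" if "e' \<in> E" for e'
  proof (rule g(3))
    have "form e' e = 0"
      using insert.hyps(2) insert.prems(1) that unfolding orthogonal_family_def
      by (metis insertCI)
    moreover have "f e' = h e'"
      using f(2) that by blast
    ultimately show "form (h e') (f e) = 0" "form (h e') (h e) = 0"
      using that f_isom[of e' e] insert.prems(2)[of e' e] by simp_all
  qed
  then have "\<forall>x\<in>insert e E. (g \<circ> f) x = h x"
    using f(2) g(2) by simp
  then show ?case
    using orthogonal_group_comp[OF f(1) g(1)] by blast
qed

lemma orthogonal_family_independent:
  assumes "orthogonal_family E"
  shows "independent E"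
proof -
  have "c e = 0" if "finite F" "F \<subseteq> E" "(\<Sum>x\<in>F. c x \<odot> x) = 0" "e \<in> F" for F c e
  proof -
    have "0 = form (\<Sum>x\<in>F. c x \<odot> x) e"
      using that by (simp add: form_simps)
    also have "\<dots> = (\<Sum>x\<in>F. if x = e then c e * form e e else 0)"
      unfolding form_left.sum form_left.scale
      using assms that by (intro sum.cong) (auto simp: orthogonal_family_def)
    also have "\<dots> = c e * form e e"
      using that by simp
    finally show "c e = 0"
      using assms that by (auto simp: orthogonal_family_def)
  qed
  then show ?thesis
    by (auto simp: dependent_explicit)
qed

definition nondegenerate_on :: "'v set \<Rightarrow> bool"
  where "nondegenerate_on W \<longleftrightarrow> (\<forall>x\<in>W. (\<forall>y\<in>W. form x y = 0) \<longrightarrow> x = 0)"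

text \<open>
Take an orthogonal family of anisotropic vectors in \<open>W\<close> of maximal size. Its orthogonal complement
\<open>U\<close> in \<open>W\<close> consists of isotropic vectors, by maximality. By polarization \<open>U\<close> is then orthogonal to
itself, hence to all of \<open>W\<close>, and therefore zero.
\<close>

lemma nondegenerate_subspace_has_orthogonal_basis:
  assumes W: "subspace W" and nondeg: "nondegenerate_on W"
  shows "\<exists>E. finite E \<and> E \<subseteq> W \<and> orthogonal_family E \<and> W \<subseteq> span E"
proof -
  define is_orth where "is_orth E \<longleftrightarrow> E \<subseteq> W \<and> orthogonal_family E" for E
  have bounded: "finite E \<and> card E \<le> dimension" if "is_orth E" for E
    using that orthogonal_family_independent independent_bound_general dim_subset_UNIV
    unfolding is_orth_def by (meson order_trans)
  have "is_orth {}"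
    by (simp add: is_orth_def orthogonal_family_def)
  then obtain E where E: "is_orth E" and maximal: "\<And>E'. is_orth E' \<Longrightarrow> card E' \<le> card E"
    using ex_has_greatest_nat[of is_orth "{}" card "Suc dimension"] bounded by (metis less_Suc_eq_le)
  have finE: "finite E" and EW: "E \<subseteq> W" and orth: "orthogonal_family E"
    using E bounded by (auto simp: is_orth_def)
  \<comment> \<open>The orthogonal projection to the span of \<open>E\<close>.\<close>
  define proj where "proj x = (\<Sum>e\<in>E. (form x e / form e e) \<odot> e)" for x
  have proj_span: "proj x \<in> span E" for x
    unfolding proj_def by (intro span_sum span_scale span_base)
  have spanE_W: "span E \<subseteq> W"
    using EW W by (rule span_minimal)
  have proj_form: "form (proj x) e = form x e" if "e \<in> E" for x e
  proof -
    have "form (proj x) e = (\<Sum>e'\<in>E. if e' = e then form x e else 0)"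
      unfolding proj_def form_left.sum form_left.scale
      using orth that by (intro sum.cong) (auto simp: orthogonal_family_def)
    then show ?thesis using finE that by simp
  qed
  define U where "U = {x \<in> W. \<forall>e\<in>E. form x e = 0}"
  have remainder: "x - proj x \<in> U" if "x \<in> W" for x
    using that W proj_span spanE_W by (auto simp: U_def form_simps proj_form intro!: subspace_diff)
  have isotropic: "form u u = 0" if "u \<in> U" for u
  proof (rule ccontr)
    assume "form u u \<noteq> 0"
    then have "is_orth (insert u E)" "u \<notin> E"
      using that EW orth symmetric by (auto simp: is_orth_def orthogonal_family_def U_def)
    then show False
      using maximal[of "insert u E"] finE by simp
  qed
  have totally_isotropic: "form u u' = 0" if "u \<in> U" "u' \<in> U" for u u'
  proof -
    have "u + u' \<in> U"
      using that W by (auto simp: U_def form_simps intro: subspace_add)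
    then have "2 * form u u' = 0"
      using isotropic[OF that(1)] isotropic[OF that(2)] isotropic[of "u + u'"] symmetric[of u u']
      by (simp add: form_simps)
    then show ?thesis by simp
  qed
  have U_zero: "u = 0" if "u \<in> U" for u
  proof -
    have "form u y = 0" if y: "y \<in> W" for y
    proof -
      have "form u (proj y) = 0"
        unfolding proj_def form_right.sum form_right.scale using \<open>u \<in> U\<close> by (simp add: U_def)
      then show ?thesis
        using totally_isotropic[OF \<open>u \<in> U\<close> remainder[OF y]] by (simp add: form_simps)
    qed
    then show ?thesis
      using nondeg that by (auto simp: nondegenerate_on_def U_def)
  qed
  have "x \<in> span E" if "x \<in> W" for x
    using U_zero[OF remainder[OF that]] proj_span[of x] by simp
  then show ?thesis
    using finE EW orth by blast
qed

text \<open>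
Witt's extension theorem for families of vectors, in terms of Gram matrices. Sending \<open>v\<^sub>i\<close> to \<open>w\<^sub>i\<close> is
prescribed only on a basis \<open>A\<close> chosen among the \<open>v\<^sub>i\<close>; the remaining values are then correct because a
vector in the non-degenerate span of the \<open>w\<^sub>j\<close> is determined by its products with them. On
an orthogonal basis of the span of the \<open>v\<^sub>i\<close>, this map agrees with an element of \<open>O(V)\<close>.
\<close>

theorem isometry_of_equal_gram:
  assumes gram: "\<And>i j. i \<in> I \<Longrightarrow> j \<in> I \<Longrightarrow> form (v i) (v j) = form (w i) (w j)"
    and nondeg_v: "nondegenerate_on (span (v ` I))"
    and nondeg_w: "nondegenerate_on (span (w ` I))"
  shows "\<exists>f\<in>orthogonal_group smul form. \<forall>i\<in>I. f (v i) = w i"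
proof -
  obtain A where A: "A \<subseteq> v ` I" "independent A" "v ` I \<subseteq> span A"
    using maximal_independent_subset by blast
  then have "\<forall>a\<in>A. \<exists>i\<in>I. v i = a" by auto
  then obtain s where s: "\<And>a. a \<in> A \<Longrightarrow> s a \<in> I \<and> v (s a) = a" by metis
  obtain h where h: "Vector_Spaces.linear smul smul h" "\<And>a. a \<in> A \<Longrightarrow> h a = w (s a)"
    using endo.linear_independent_extend[OF A(2), of "\<lambda>a. w (s a)"] by blast
  interpret h: Vector_Spaces.linear smul smul h by (rule h(1))
  have w_span: "w j \<in> span (w ` I)" if "j \<in> I" for j
    using that by (intro span_base) auto
  have h_span: "h x \<in> span (w ` I)" if "x \<in> span A" for x
    using that by (induction rule: span_induct_alt)
      (auto simp: h.zero h.add h.scale h(2) s span_zero intro!: span_add span_scale w_span)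
  have h_w: "form (h x) (w j) = form x (v j)" if "x \<in> span A" "j \<in> I" for x j
    using that(1)
  proof (induction rule: span_induct_alt)
    case (step c a x)
    have "form (w (s a)) (w j) = form a (v j)"
      using gram[of "s a" j] s[OF step(1)] that(2) by simp
    then show ?case
      using step by (simp add: h.add h.scale h(2) form_simps)
  qed (simp add: h.zero form_simps)
  have h_v: "h (v i) = w i" if i: "i \<in> I" for i
  proof -
    have vi: "v i \<in> span A" using A(3) i by auto
    have "form (h (v i) - w i) y = 0" if "y \<in> span (w ` I)" for y
      using that
      by (induction rule: span_induct_alt)
        (auto simp: form_simps h_w[OF vi] gram[OF i])
    moreover have "h (v i) - w i \<in> span (w ` I)"
      using h_span[OF vi] w_span[OF i] by (rule span_diff)
    ultimately have "h (v i) - w i = 0"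
      using nondeg_w unfolding nondegenerate_on_def by blast
    then show ?thesis by simp
  qed
  have h_isom: "form (h x) (h y) = form x y"
    if x: "x \<in> span (v ` I)" and y: "y \<in> span (v ` I)" for x y
  proof -
    have x': "x \<in> span A"
      using x A(3) span_minimal subspace_span by blast
    show ?thesis using y
      by (induction rule: span_induct_alt)
        (auto simp: h.zero h.add h.scale form_simps h_v h_w[OF x'])
  qed
  obtain E where E: "finite E" "E \<subseteq> span (v ` I)" "orthogonal_family E" "span (v ` I) \<subseteq> span E"
    using nondegenerate_subspace_has_orthogonal_basis[OF subspace_span nondeg_v] by blast
  obtain f where f: "f \<in> orthogonal_group smul form" "\<forall>e\<in>E. f e = h e"
    using extend_isometry_of_orthogonal_family[OF E(1,3), of h] E(2) h_isom by blast
  have f_lin: "Vector_Spaces.linear smul smul f"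
    using f(1) by (simp add: orthogonal_group_def)
  have "f (v i) = w i" if i: "i \<in> I" for i
  proof -
    have "v i \<in> span E"
      using E(4) i span_base[of "v i" "v ` I"] by auto
    then have "f (v i) = h (v i)"
      using endo.linear_eq_on[OF f_lin h(1)] f(2) by blast
    then show ?thesis using h_v[OF i] by simp
  qed
  then show ?thesis using f(1) by blast
qed

section \<open>Configurations with the same labelled distances\<close>

lemma nondegenerate_on_UNIV: "nondegenerate_on UNIV"
  using nondegenerate by (auto simp: nondegenerate_on_def)

text \<open>
A linear relation between the vectors is also one between the columns of their Gram matrix, so the
vectors indexed by \<open>J\<close> are independent. If there are as many of them as the dimension, they span
the whole space. Otherwise \<open>J = I\<close>, and a vector of the span that is orthogonal to the span has
coefficients that form a relation between the columns.
\<close>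

lemma nondegenerate_on_span_if_independent_gram_columns:
  assumes I: "finite I" "J \<subseteq> I"
    and indep: "independent_columns I J (\<lambda>i j. form (v i) (v j))"
    and card_J: "card J = min (card I) dimension"
  shows "nondegenerate_on (span (v ` I))"
proof -
  have finJ: "finite J"
    using I finite_subset by blast
  have relation_trivial: "c j = 0" if "(\<Sum>j\<in>J. c j \<odot> v j) = 0" "j \<in> J" for c j
  proof -
    have "(\<Sum>j\<in>J. c j * form (v i) (v j)) = form (v i) (\<Sum>j\<in>J. c j \<odot> v j)" for i
      unfolding form_right.sum form_right.scale ..
    then show ?thesis
      using indep that unfolding independent_columns_def by (simp add: form_simps)
  qed
  have inj: "inj_on v J"
  proof (rule inj_onI, rule ccontr)
    fix j k assume jk: "j \<in> J" "k \<in> J" "v j = v k" "j \<noteq> k"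
    \<comment> \<open>Two equal vectors with different indices would satisfy this nontrivial relation.\<close>
    define c :: "_ \<Rightarrow> 'k" where "c l = (if l = j then 1 else 0) - (if l = k then 1 else 0)" for l
    have "(\<Sum>l\<in>J. c l \<odot> v l) =
        (\<Sum>l\<in>J. (if l = j then v j else 0)) - (\<Sum>l\<in>J. (if l = k then v k else 0))"
      unfolding sum_subtractf[symmetric]
      by (intro sum.cong) (auto simp: c_def scale_left_diff_distrib)
    also have "\<dots> = 0"
      using jk finJ by simp
    finally show False
      using relation_trivial[of c j] jk by (simp add: c_def)
  qed
  have independent_J: "independent (v ` J)"
    unfolding independent_explicit
    using finJ relation_trivial by (auto simp: sum.reindex[OF inj])
  show ?thesis
  proof (cases "card J = card I")
    case True
    then have JI: "J = I"
      using I card_subset_eq by blast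
    show ?thesis
      unfolding nondegenerate_on_def
    proof (intro ballI impI)
      fix x assume x: "x \<in> span (v ` I)" "\<forall>y\<in>span (v ` I). form x y = 0"
      then obtain c where "x = (\<Sum>b\<in>v ` I. c b \<odot> b)"
        using I(1) by (auto simp: span_finite)
      then have c: "x = (\<Sum>j\<in>J. c (v j) \<odot> v j)"
        using inj JI by (simp add: sum.reindex)
      have "(\<Sum>j\<in>J. c (v j) * form (v i) (v j)) = 0" if "i \<in> I" for i
      proof -
        have "(\<Sum>j\<in>J. c (v j) * form (v i) (v j)) = form (v i) x"
          unfolding c form_right.sum form_right.scale ..
        also have "\<dots> = 0"
          using x(2) that span_base[of "v i" "v ` I"] symmetric by auto
        finally show ?thesis .
      qed
      then have "\<forall>j\<in>J. c (v j) = 0"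
        using indep unfolding independent_columns_def
        by (elim allE[of _ "\<lambda>j. c (v j)"]) blast
      then show "x = 0"
        by (simp add: c)
    qed
  next
    case False
    then have "card (v ` J) = dimension"
      using card_J card_image[OF inj] by (auto simp: min_def split: if_splits)
    then have "UNIV \<subseteq> span (v ` J)"
      using card_ge_dim_independent[OF subset_UNIV independent_J] by (simp add: dim_UNIV dimension_def)
    then have "span (v ` I) = UNIV"
      using span_mono[of "v ` J" "v ` I"] I(2) by blast
    then show ?thesis
      using nondegenerate_on_UNIV by simp
  qed
qed

lemma polarization:
  "form (x - z) (y - z) = (dist_form form x z + dist_form form y z - dist_form form x y) / 2"
  by (simp add: dist_form_def form_simps symmetric[of y x] symmetric[of z x] symmetric[of z y])

lemma dist_form_commute: "dist_form form x y = dist_form form y x"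
  using form_left.neg[of "x - y" "x - y"] form_right.neg[of "y - x" "x - y"]
  by (simp add: dist_form_def)

lemma dist_form_self: "dist_form form x x = 0"
  by (simp add: dist_form_def form_simps)

text \<open>
The generated group consists of products of generators and their inverses, so the induction has to
carry bijectivity along: composition and inverse in \<open>BijGroup UNIV\<close> are the usual ones only for
bijections.
\<close>

lemma affine_orthogonal_group_preserves_dist_form:
  assumes "g \<in> affine_orthogonal_group smul form"
  shows "dist_form form (g x) (g y) = dist_form form x y"
proof -
  define isometric where
    "isometric h \<longleftrightarrow> bij h \<and> (\<forall>x y. dist_form form (h x) (h y) = dist_form form x y)" for h
  have Bij_UNIV: "h \<in> Bij UNIV \<longleftrightarrow> bij h" for h :: "'v \<Rightarrow> 'v"
    by (simp add: Bij_def)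
  have generator: "isometric h" if "h \<in> orthogonal_group smul form \<union> translation_maps" for h
    using that
  proof
    assume "h \<in> orthogonal_group smul form"
    then have h: "Vector_Spaces.linear smul smul h" "bij h" "\<And>x y. form (h x) (h y) = form x y"
      by (auto simp: orthogonal_group_def)
    interpret h: Vector_Spaces.linear smul smul h by (rule h(1))
    show ?thesis
      using h(2,3) by (simp add: isometric_def dist_form_def flip: h.diff)
  next
    assume "h \<in> translation_maps"
    then show ?thesis
      by (auto simp: translation_maps_def isometric_def dist_form_def bij_plus_right)
  qed
  have "isometric g"
    using assms unfolding affine_orthogonal_group_def
  proof (induction rule: generate.induct)
    case one
    show ?case
      by (simp add: BijGroup_def isometric_def bij_id[unfolded id_def])
  next
    case (incl h)
    then show ?case by (rule generator)
  next
    case (inv h)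
    have h: "bij h" "\<And>x y. dist_form form (h x) (h y) = dist_form form x y"
      using generator[OF inv] by (auto simp: isometric_def)
    then have "inv\<^bsub>BijGroup UNIV\<^esub> h = inv_into UNIV h"
      by (simp add: inv_BijGroup Bij_UNIV restrict_UNIV)
    moreover have "dist_form form (inv_into UNIV h x) (inv_into UNIV h y) = dist_form form x y" for x y
      using h(2)[of "inv_into UNIV h x" "inv_into UNIV h y"] h(1)
      by (simp add: surj_f_inv_f bij_is_surj)
    ultimately show ?case
      using h(1) by (simp add: isometric_def bij_imp_bij_inv)
  next
    case (eng h1 h2)
    then have "h1 \<otimes>\<^bsub>BijGroup UNIV\<^esub> h2 = h1 \<circ> h2"
      by (auto simp: BijGroup_def Bij_UNIV isometric_def compose_def)
    then show ?case
      using eng.IH bij_comp[of h2 h1] unfolding isometric_def by simp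
  qed
  then show ?thesis by (simp add: isometric_def)
qed

lemma affine_map_in_affine_orthogonal_group:
  assumes "f \<in> orthogonal_group smul form"
  shows "(\<lambda>x. f x + t) \<in> affine_orthogonal_group smul form"
proof -
  have "(\<lambda>x. x + t) \<otimes>\<^bsub>BijGroup UNIV\<^esub> f \<in> affine_orthogonal_group smul form"
    unfolding affine_orthogonal_group_def
    by (intro generate.eng generate.incl) (auto simp: assms translation_maps_def)
  moreover have "f \<in> Bij UNIV" "(\<lambda>x. x + t) \<in> Bij UNIV"
    using assms by (auto simp: Bij_def orthogonal_group_def bij_plus_right)
  ultimately show ?thesis
    by (simp add: BijGroup_def compose_def restrict_UNIV)
qed

text \<open>
The index shift matches that of \<open>distance_matrix\<close>, whose rows and columns start at \<open>0\<close>.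
\<close>

definition edges :: "nat \<Rightarrow> (nat \<Rightarrow> 'v) \<Rightarrow> nat \<Rightarrow> 'v"
  where "edges n Q j = Q (j + 1) - Q n"

text \<open>
Equal distances give equal Gram matrices of the edges by polarization, so some element of \<open>O(V)\<close>
carries the edges of \<open>Q\<close> to those of \<open>R\<close>; a translation then matches the last points.
\<close>

lemma same_orbit_iff_equal_distances:
  assumes n: "n \<ge> 1" and R: "R \<in> configs n"
    and nondeg: "nondegenerate_on (span (edges n Q ` {..<n - 1}))"
      "nondegenerate_on (span (edges n R ` {..<n - 1}))"
  shows "same_orbit smul form n Q R \<longleftrightarrow>
    (\<forall>(i, j)\<in>index_pairs n. dist_form form (Q i) (Q j) = dist_form form (R i) (R j))"
    (is "_ \<longleftrightarrow> ?same_distances")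
proof
  assume "same_orbit smul form n Q R"
  then obtain g where g: "g \<in> affine_orthogonal_group smul form" "R = (\<lambda>i\<in>{1..n}. g (Q i))"
    by (auto simp: same_orbit_def)
  then show ?same_distances
    by (auto simp: index_pairs_def affine_orthogonal_group_preserves_dist_form)
next
  assume same: ?same_distances
  have dist_eq: "dist_form form (Q i) (Q j) = dist_form form (R i) (R j)"
    if "i \<in> {1..n}" "j \<in> {1..n}" for i j
  proof (cases i j rule: linorder_cases)
    case less
    then show ?thesis
      using same that by (auto simp: index_pairs_def)
  next
    case greater
    then have "dist_form form (Q j) (Q i) = dist_form form (R j) (R i)"
      using same that by (auto simp: index_pairs_def)
    then show ?thesis
      by (simp add: dist_form_commute)
  qed (simp add: dist_form_self)
  have "form (edges n Q i) (edges n Q j) = form (edges n R i) (edges n R j)"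
    if "i \<in> {..<n - 1}" "j \<in> {..<n - 1}" for i j
    using that unfolding edges_def polarization by (simp add: dist_eq)
  then obtain f where f: "f \<in> orthogonal_group smul form"
    "\<And>i. i < n - 1 \<Longrightarrow> f (edges n Q i) = edges n R i"
    using isometry_of_equal_gram[OF _ nondeg] by auto
  interpret f: Vector_Spaces.linear smul smul f
    using f(1) by (simp add: orthogonal_group_def)
  define g where "g x = f x + (R n - f (Q n))" for x
  have "g (Q i) = R i" if "i \<in> {1..n}" for i
  proof (cases "i = n")
    case False
    then have "i - 1 < n - 1" "i - 1 + 1 = i"
      using that by auto
    then have "f (Q i - Q n) = R i - R n"
      using f(2)[of "i - 1"] unfolding edges_def by simp
    then show ?thesis
      by (simp add: g_def f.diff algebra_simps)
  qed (simp add: g_def)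
  then have "R = (\<lambda>i\<in>{1..n}. g (Q i))"
    using R by (auto simp: configs_def PiE_def extensional_def restrict_def)
  moreover have "g \<in> affine_orthogonal_group smul form"
    unfolding g_def using f(1) by (rule affine_map_in_affine_orthogonal_group)
  ultimately show "same_orbit smul form n Q R"
    by (auto simp: same_orbit_def)
qed

lemma distance_matrix_index:
  assumes "i < n - 1" "j < n - 1"
  shows "distance_matrix form n Q $$ (i, j) = - 2 * form (edges n Q i) (edges n Q j)"
  using assms by (simp add: distance_matrix_def edges_def polarization)

lemma form_coordinates:
  "form x y = (\<Sum>b\<in>B. \<Sum>a\<in>B.
    representation B y b * (representation B x a * form a b))"
proof -
  have expand: "(\<Sum>b\<in>B. representation B z b \<odot> b) = z" for z
    by (rule sum_representation_eq)
      (simp_all add: independent_Basis span_Basis finite_Basis)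
  have "form x y = form (\<Sum>b\<in>B. representation B x b \<odot> b)
      (\<Sum>b\<in>B. representation B y b \<odot> b)"
    by (simp only: expand)
  then show ?thesis
    by (simp only: form_left.sum form_left.scale form_right.sum form_right.scale sum_distrib_left)
qed

end

section \<open>Continuity of the distances\<close>

lemma metric_on_configs:
  assumes "vector_space smul" "norm_on_configs smul n nrm"
  shows "Metric_space (configs n) (\<lambda>P Q. nrm (\<lambda>i\<in>{1..n}. P i - Q i))"
proof -
  interpret vector_space smul by fact
  interpret norm_on_configs smul n nrm by fact
  have config: "(\<lambda>i\<in>{1..n}. f i) \<in> configs n" for f :: "nat \<Rightarrow> 'b"
    by (simp add: configs_def)
  show ?thesis
  proof
    fix P Q R :: "nat \<Rightarrow> 'b"
    show "nrm (\<lambda>i\<in>{1..n}. P i - Q i) \<ge> 0"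
      by (intro nonneg config)
    have "(\<lambda>i\<in>{1..n}. smul (- 1) ((\<lambda>i\<in>{1..n}. Q i - P i) i)) = (\<lambda>i\<in>{1..n}. P i - Q i)"
      by (auto simp: restrict_def)
    then show "nrm (\<lambda>i\<in>{1..n}. P i - Q i) = nrm (\<lambda>i\<in>{1..n}. Q i - P i)"
      using homogeneous[OF config, of "- 1" "\<lambda>i. Q i - P i"] by simp
    show "nrm (\<lambda>i\<in>{1..n}. P i - Q i) = 0 \<longleftrightarrow> P = Q" if "P \<in> configs n" "Q \<in> configs n"
      using that eq_zero_iff[OF config, of "\<lambda>i. P i - Q i"]
      by (auto simp: configs_def intro: PiE_ext)
    have "(\<lambda>i\<in>{1..n}. (\<lambda>i\<in>{1..n}. P i - Q i) i + (\<lambda>i\<in>{1..n}. Q i - R i) i) =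
        (\<lambda>i\<in>{1..n}. P i - R i)"
      by (auto simp: restrict_def)
    then show "nrm (\<lambda>i\<in>{1..n}. P i - R i) \<le>
        nrm (\<lambda>i\<in>{1..n}. P i - Q i) + nrm (\<lambda>i\<in>{1..n}. Q i - R i)"
      using triangle[OF config config, of "\<lambda>i. P i - Q i" "\<lambda>i. Q i - R i"] by simp
  qed
qed

text \<open>
A configuration of \<open>n\<close> points has coordinates indexed by pairs of a point index and a basis
vector. As the given norm bounds them, each coordinate is a Lipschitz function of the
configuration.
\<close>

lemma tendsto_coordinate:
  fixes smul :: "'k::{real_normed_field, heine_borel} \<Rightarrow> 'v::ab_group_add \<Rightarrow> 'v" and B :: "'v set"
  assumes V: "finite_dimensional_vector_space smul B"
    and nrm: "norm_on_configs smul n nrm"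
    and P: "P \<in> configs n" and i: "i \<in> {1..n}" and b: "b \<in> B"
  shows "((\<lambda>Q. module.representation smul B (Q i) b) \<longlongrightarrow>
    module.representation smul B (P i) b) (nhdsin (config_topology n nrm) P)"
proof -
  interpret V: finite_dimensional_vector_space smul B by fact
  interpret norm_on_configs smul n nrm by fact
  interpret metric: Metric_space "configs n" "\<lambda>P Q. nrm (\<lambda>i\<in>{1..n}. P i - Q i)"
    using V.vector_space_axioms nrm by (rule metric_on_configs)
  define p where "p x = nrm (\<lambda>i\<in>{1..n}. \<Sum>b\<in>B. smul (x (i, b)) b)" for x
  have config: "(\<lambda>i\<in>{1..n}. f i) \<in> configs n" for f :: "nat \<Rightarrow> 'v"
    by (simp add: configs_def)
  have "\<exists>C>0. \<forall>x. \<forall>ib\<in>{1..n} \<times> B. norm (x ib) \<le> C * p x"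
  proof (rule coordinates_bounded_by_norm)
    show "finite ({1..n} \<times> B)"
      using V.finite_Basis by simp
    show "p (\<lambda>ib. x ib + y ib) \<le> p x + p y" for x y
    proof -
      have "p (\<lambda>ib. x ib + y ib) = nrm (\<lambda>i\<in>{1..n}.
          (\<lambda>i\<in>{1..n}. \<Sum>b\<in>B. smul (x (i, b)) b) i +
          (\<lambda>i\<in>{1..n}. \<Sum>b\<in>B. smul (y (i, b)) b) i)"
        unfolding p_def
        by (intro arg_cong[of _ _ nrm] restrict_ext) (simp add: V.scale_left_distrib sum.distrib)
      then show ?thesis
        unfolding p_def using triangle[OF config config] by simp
    qed
    show "p (\<lambda>ib. c * x ib) = norm c * p x" for c x
    proof -
      have "p (\<lambda>ib. c * x ib) =
          nrm (\<lambda>i\<in>{1..n}. smul c ((\<lambda>i\<in>{1..n}. \<Sum>b\<in>B. smul (x (i, b)) b) i))"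
        unfolding p_def
        by (intro arg_cong[of _ _ nrm] restrict_ext) (simp add: V.scale_sum_right)
      then show ?thesis
        unfolding p_def using homogeneous[OF config] by simp
    qed
    show "x ib = 0" if p_zero: "p x = 0" and mem: "ib \<in> {1..n} \<times> B" for x ib
    proof -
      obtain i b where ib: "ib = (i, b)" "i \<in> {1..n}" "b \<in> B"
        using mem by auto
      have "(\<Sum>b\<in>B. smul (x (i, b)) b) = 0"
        using p_zero eq_zero_iff[OF config] ib(2) unfolding p_def by force
      then show ?thesis
        using V.independentD[OF V.independent_Basis V.finite_Basis subset_refl, of "\<lambda>b. x (i, b)"] ib
        by simp
    qed
    show "p x = p y" if "\<And>ib. ib \<in> {1..n} \<times> B \<Longrightarrow> x ib = y ib" for x y
      unfolding p_def by (intro arg_cong[of _ _ nrm] restrict_ext sum.cong) (auto simp: that)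
  qed
  then obtain C where C: "C > 0"
    and bound: "\<And>x i b. i \<in> {1..n} \<Longrightarrow> b \<in> B \<Longrightarrow> norm (x (i, b)) \<le> C * p x"
    by blast
  have rep_diff: "V.representation B (x - y) b =
      V.representation B x b - V.representation B y b" for x y
    by (simp add: V.representation_diff V.independent_Basis V.span_Basis)
  have expand: "(\<Sum>b\<in>B. smul (V.representation B z b) b) = z" for z
    by (rule V.sum_representation_eq)
      (simp_all add: V.independent_Basis V.span_Basis V.finite_Basis)
  have lipschitz: "dist (V.representation B (Q i) b) (V.representation B (P i) b) \<le>
      C * nrm (\<lambda>i\<in>{1..n}. P i - Q i)" for Q
    using bound[OF i b, of "\<lambda>(i, b). V.representation B (P i - Q i) b"]
    by (simp add: p_def expand rep_diff dist_norm norm_minus_commute)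
  show ?thesis
  proof (rule tendstoI)
    fix e :: real assume e: "e > 0"
    show "\<forall>\<^sub>F Q in nhdsin (config_topology n nrm) P.
        dist (V.representation B (Q i) b) (V.representation B (P i) b) < e"
      unfolding eventually_nhdsin config_topology_def
    proof (intro disjI2 exI[of _ "metric.mball P (e / C)"] conjI ballI)
      fix Q assume "Q \<in> metric.mball P (e / C)"
      then have "nrm (\<lambda>i\<in>{1..n}. P i - Q i) < e / C"
        unfolding metric.in_mball by blast
      then have "C * nrm (\<lambda>i\<in>{1..n}. P i - Q i) < e"
        using C by (simp add: field_simps)
      then show "dist (V.representation B (Q i) b) (V.representation B (P i) b) < e"
        using lipschitz[of Q] by simp
    next
      show "openin metric.mtopology (metric.mball P (e / C))"
        by (rule metric.openin_mball)
      show "P \<in> metric.mball P (e / C)"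
        unfolding metric.centre_in_mball_iff using P C e by simp
    qed
  qed
qed

lemma tendsto_form_of_differences:
  fixes smul :: "'k::{real_normed_field, heine_borel} \<Rightarrow> 'v::ab_group_add \<Rightarrow> 'v" and B :: "'v set"
  assumes space: "quadratic_space smul B form"
    and nrm: "norm_on_configs smul n nrm"
    and P: "P \<in> configs n"
    and ijkl: "i \<in> {1..n}" "j \<in> {1..n}" "k \<in> {1..n}" "l \<in> {1..n}"
  shows "((\<lambda>Q. form (Q i - Q j) (Q k - Q l)) \<longlongrightarrow> form (P i - P j) (P k - P l))
    (nhdsin (config_topology n nrm) P)"
proof -
  interpret quadratic_space smul B form by fact
  have rep_diff: "representation B (x - y) b =
      representation B x b - representation B y b" for x y b
    by (simp add: representation_diff independent_Basis span_Basis)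
  have "form (Q i - Q j) (Q k - Q l) = (\<Sum>b\<in>B. \<Sum>a\<in>B.
      (representation B (Q k) b - representation B (Q l) b) *
      ((representation B (Q i) a - representation B (Q j) a) * form a b))" for Q
    by (subst form_coordinates) (simp only: rep_diff)
  then show ?thesis
    by (simp only:)
      (intro tendsto_intros tendsto_coordinate finite_dimensional_vector_space_axioms nrm P ijkl)
qed


section \<open>Orbits near a configuration with distinct distances\<close>

text \<open>
The value \<open>g p\<close> occurs as some \<open>h q\<close>, and then \<open>f p\<close> and \<open>f q\<close> are closer than \<open>\<delta> p + \<delta> q\<close>. This is
at most \<open>2 max (\<delta> p) (\<delta> q)\<close>, which contradicts separation unless \<open>p = q\<close>.
\<close>

lemma equal_multisets_near_injective_family:
  fixes f g h :: "'a \<Rightarrow> 'k::metric_space"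
  assumes fin: "finite S"
    and separated: "\<And>p q. p \<in> S \<Longrightarrow> q \<in> S \<Longrightarrow> p \<noteq> q \<Longrightarrow> 2 * \<delta> p \<le> dist (f p) (f q)"
    and near: "\<And>p. p \<in> S \<Longrightarrow> dist (g p) (f p) < \<delta> p" "\<And>p. p \<in> S \<Longrightarrow> dist (h p) (f p) < \<delta> p"
    and eq: "image_mset g (mset_set S) = image_mset h (mset_set S)"
    and p: "p \<in> S"
  shows "g p = h p"
proof -
  have "g ` S = h ` S"
    using arg_cong[OF eq, of set_mset] fin by simp
  then obtain q where q: "q \<in> S" "g p = h q"
    using p by blast
  have "dist (f p) (f q) < \<delta> p + \<delta> q"
    using near(1)[OF p] near(2)[OF q(1)] q(2) dist_triangle[of "f p" "f q" "g p"]
    by (simp add: dist_commute)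
  then have "p = q"
    using separated[OF p q(1)] separated[OF q(1) p] by (force simp: dist_commute)
  then show ?thesis
    using q by simp
qed

text \<open>
Real and complex scalars are treated at once, as a normed field whose bounded closed sets are
compact. The neighborhood consists of the configurations near \<open>P\<close> on
which the two conditions discussed at the beginning hold: each distance is within the
separation radius of the corresponding distance of \<open>P\<close>, and the span of the edges is
non-degenerate.
\<close>

theorem orbits_near_config_with_distinct_distances:
  fixes smul :: "'k::{real_normed_field, heine_borel} \<Rightarrow> 'v::ab_group_add \<Rightarrow> 'v"
  assumes n: "n \<ge> 1"
    and dim: "has_dimension smul m"
    and form: "nondegenerate_symmetric_form smul form"
    and nrm: "norm_on_configs smul n nrm"
    and P: "P \<in> configs n"
    and distinct: "distinct_distances form n P"
    and rank: "vec_space.rank (n - 1) (distance_matrix form n P) = min (n - 1) m"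
  shows "\<exists>N. neighborhood n nrm P N \<and>
    (\<forall>Q\<in>N. \<forall>R\<in>N. same_orbit smul form n Q R \<longleftrightarrow>
      distance_distribution form n Q = distance_distribution form n R)"
proof -
  obtain B where basis: "finite_dimensional_vector_space smul B" "card B = m"
    using dim by (auto simp: has_dimension_def)
  interpret quadratic_space smul B form
    using basis(1) form by (simp add: quadratic_space_def)
  define F where "F = nhdsin (config_topology n nrm) P"
  define d where "d Q = (\<lambda>(i, j). dist_form form (Q i) (Q j))" for Q :: "nat \<Rightarrow> 'v"
  let ?mset = "\<lambda>Q. image_mset (d Q) (mset_set (index_pairs n))"
  have finite_pairs: "finite (index_pairs n)"
    by (rule finite_subset[of _ "{1..n} \<times> {1..n}"]) (auto simp: index_pairs_def)
  have topspace: "topspace (config_topology n nrm) = configs n"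
    unfolding config_topology_def
    using Metric_space.topspace_mtopology metric_on_configs[OF vector_space_axioms nrm] by blast

  obtain J where J: "J \<subseteq> {..<n - 1}" "card J = min (n - 1) m"
    "independent_columns {..<n - 1} J (\<lambda>i j. distance_matrix form n P $$ (i, j))"
    using rank_attained_by_independent_columns[of "distance_matrix form n P" "n - 1" "n - 1"] rank
    by (auto simp: distance_matrix_def)
  have finJ: "finite J"
    using J(1) finite_subset by blast
  have "\<forall>i\<in>{..<n - 1}. \<forall>j\<in>J.
      distance_matrix form n P $$ (i, j) = - 2 * form (edges n P i) (edges n P j)"
    using J(1) by (auto simp: distance_matrix_index)
  then have "independent_columns {..<n - 1} J (\<lambda>i j. - 2 * form (edges n P i) (edges n P j))"
    using J(3) by (simp add: independent_columns_def cong: sum.cong)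
  then have "independent_columns {..<n - 1} J (\<lambda>i j. form (edges n P i) (edges n P j))"
    unfolding independent_columns_def
    by (simp add: sum_negf mult.left_commute[of _ 2] flip: sum_distrib_left)
  then have "\<forall>\<^sub>F Q in F. independent_columns {..<n - 1} J (\<lambda>i j. form (edges n Q i) (edges n Q j))"
  proof (rule eventually_independent_columns[OF finite_lessThan finJ])
    fix i j assume "i \<in> {..<n - 1}" "j \<in> J"
    then have "i + 1 \<in> {1..n}" "j + 1 \<in> {1..n}" "n \<in> {1..n}"
      using J(1) n by auto
    then show "((\<lambda>Q. form (edges n Q i) (edges n Q j)) \<longlongrightarrow> form (edges n P i) (edges n P j)) F"
      unfolding edges_def F_def
      by (intro tendsto_form_of_differences[OF quadratic_space_axioms nrm P])
  qed
  then have nondeg: "\<forall>\<^sub>F Q in F. nondegenerate_on (span (edges n Q ` {..<n - 1}))"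
  proof eventually_elim
    case (elim Q)
    then show ?case
      using J basis(2)
      by (intro nondegenerate_on_span_if_independent_gram_columns[OF _ J(1)])
        (auto simp: dimension_def)
  qed

  have "\<exists>\<delta>>0. \<forall>q\<in>index_pairs n. p \<noteq> q \<longrightarrow> 2 * \<delta> \<le> dist (d P p) (d P q)"
    if "p \<in> index_pairs n" for p
  proof -
    obtain e where e: "e > 0" "\<forall>x\<in>d P ` index_pairs n. x \<noteq> d P p \<longrightarrow> e \<le> dist (d P p) x"
      using finite_set_avoid[of "d P ` index_pairs n" "d P p"] finite_pairs by blast
    have "d P q \<noteq> d P p" if "q \<in> index_pairs n" "p \<noteq> q" for q
      using distinct that \<open>p \<in> index_pairs n\<close> unfolding distinct_distances_def d_def inj_on_def by metis
    then show ?thesis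
      using e by (intro exI[of _ "e / 2"]) auto
  qed
  then obtain \<delta> where \<delta>: "\<And>p. p \<in> index_pairs n \<Longrightarrow> \<delta> p > 0"
    "\<And>p q. p \<in> index_pairs n \<Longrightarrow> q \<in> index_pairs n \<Longrightarrow> p \<noteq> q \<Longrightarrow> 2 * \<delta> p \<le> dist (d P p) (d P q)"
    by metis
  have "\<forall>\<^sub>F Q in F. dist (d Q p) (d P p) < \<delta> p" if p: "p \<in> index_pairs n" for p
  proof -
    obtain i j where "p = (i, j)" "i \<in> {1..n}" "j \<in> {1..n}"
      using p by (cases p) (auto simp: index_pairs_def)
    then have "((\<lambda>Q. d Q p) \<longlongrightarrow> d P p) F"
      unfolding d_def F_def dist_form_def
      using tendsto_form_of_differences[OF quadratic_space_axioms nrm P] by simp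
    then show ?thesis
      using \<delta>(1)[OF p] by (rule tendstoD)
  qed
  then have near: "\<forall>\<^sub>F Q in F. \<forall>p\<in>index_pairs n. dist (d Q p) (d P p) < \<delta> p"
    using finite_pairs by (simp add: eventually_ball_finite_distrib)

  have "\<forall>\<^sub>F Q in F. nondegenerate_on (span (edges n Q ` {..<n - 1})) \<and>
      (\<forall>p\<in>index_pairs n. dist (d Q p) (d P p) < \<delta> p)"
    using nondeg near by eventually_elim simp
  then obtain N where N: "openin (config_topology n nrm) N" "P \<in> N"
    "\<And>Q. Q \<in> N \<Longrightarrow> nondegenerate_on (span (edges n Q ` {..<n - 1}))"
    "\<And>Q p. Q \<in> N \<Longrightarrow> p \<in> index_pairs n \<Longrightarrow> dist (d Q p) (d P p) < \<delta> p"
    unfolding F_def eventually_nhdsin using P topspace by blast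
  have N_configs: "N \<subseteq> configs n"
    using openin_subset[OF N(1)] topspace by simp
  have "same_orbit smul form n Q R \<longleftrightarrow> distance_distribution form n Q = distance_distribution form n R"
    if QR: "Q \<in> N" "R \<in> N" for Q R
  proof -
    have "R \<in> configs n"
      using N_configs QR(2) by blast
    then have "same_orbit smul form n Q R \<longleftrightarrow>
        (\<forall>(i, j)\<in>index_pairs n. dist_form form (Q i) (Q j) = dist_form form (R i) (R j))"
      using N(3)[OF QR(1)] N(3)[OF QR(2)] by (rule same_orbit_iff_equal_distances[OF n])
    also have "\<dots> \<longleftrightarrow> (\<forall>p\<in>index_pairs n. d Q p = d R p)"
      by (simp add: d_def split_beta)
    also have "\<dots> \<longleftrightarrow> ?mset Q = ?mset R"
    proof
      assume "\<forall>p\<in>index_pairs n. d Q p = d R p"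
      then show "?mset Q = ?mset R"
        using finite_pairs by (intro image_mset_cong) simp
    next
      assume "?mset Q = ?mset R"
      then show "\<forall>p\<in>index_pairs n. d Q p = d R p"
        using equal_multisets_near_injective_family[OF finite_pairs, of \<delta> "d P" "d Q" "d R"]
          \<delta>(2) N(4)[OF QR(1)] N(4)[OF QR(2)] by blast
    qed
    finally show ?thesis
      by (simp add: distance_distribution_def d_def)
  qed
  then show ?thesis
    using N(1,2) N_configs by (intro exI[of _ N]) (auto simp: neighborhood_def)
qed

text \<open>
Real and complex numbers both form a normed field with the Heine-Borel property, so each half is an
instance of the preceding theorem.
\<close>

theorem proposition1p12:
  fixes n m :: nat
    and smulR :: "real \<Rightarrow> 'v::ab_group_add \<Rightarrow> 'v"
    and formR :: "'v \<Rightarrow> 'v \<Rightarrow> real"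
    and nrmR :: "(nat \<Rightarrow> 'v) \<Rightarrow> real"
    and PR :: "nat \<Rightarrow> 'v"
    and smulC :: "complex \<Rightarrow> 'w::ab_group_add \<Rightarrow> 'w"
    and formC :: "'w \<Rightarrow> 'w \<Rightarrow> complex"
    and nrmC :: "(nat \<Rightarrow> 'w) \<Rightarrow> real"
    and PC :: "nat \<Rightarrow> 'w"
  assumes "n \<ge> 1"
  shows
    "(has_dimension smulR m \<and> nondegenerate_symmetric_form smulR formR \<and>
      norm_on_configs smulR n nrmR \<and> PR \<in> configs n \<and>
      distinct_distances formR n PR \<and>
      vec_space.rank (n - 1) (distance_matrix formR n PR) = min (n - 1) m \<longrightarrow>
      (\<exists>N. neighborhood n nrmR PR N \<and>
        (\<forall>Q\<in>N. \<forall>R\<in>N. same_orbit smulR formR n Q R \<longleftrightarrow>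
          distance_distribution formR n Q = distance_distribution formR n R)))
    \<and>
     (has_dimension smulC m \<and> nondegenerate_symmetric_form smulC formC \<and>
      norm_on_configs smulC n nrmC \<and> PC \<in> configs n \<and>
      distinct_distances formC n PC \<and>
      vec_space.rank (n - 1) (distance_matrix formC n PC) = min (n - 1) m \<longrightarrow>
      (\<exists>N. neighborhood n nrmC PC N \<and>
        (\<forall>Q\<in>N. \<forall>R\<in>N. same_orbit smulC formC n Q R \<longleftrightarrow>
          distance_distribution formC n Q = distance_distribution formC n R)))"
  by (intro conjI impI; elim conjE)
    (rule orbits_near_config_with_distinct_distances[OF assms]; assumption)+

end
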